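(* There exists a unique $a\in(1/2,1/\sqrt2)$ such that $$\mu''(r)>0\quad\text{for } 0<r<a,\qquad \mu''(r)<0\quad\text{for } a<r<1 .$$ Moreover, if for $y\in\mathbb R$ and $0<r<1$ one sets $$N_y(r)=r-\frac{\mu(r)-y}{\mu'(r)},$$ then $$N_{\pi/2}(a)<1 .$$
   Context: For $0<r<1$ let $r'=\sqrt{1-r^2}$ and let $$\mathbf K(r)=\int_0^{\pi/2}\frac{dt}{\sqrt{1-r^2\sin^2 t}}$$ be Legendre's complete elliptic integral of the first kind. The Grötzsch modulus function is $$\mu(r)=\frac{\pi}{2}\,\frac{\mathbf K(r')}{\mathbf K(r)},\qquad 0<r<1.$$ It is a smooth, strictly decreasing homeomorphism from $(0,1)$ onto $(0,\infty)$, with derivative $\mu'(r)=-\dfrac{\pi^2}{4r(1-r^2)\mathbf K(r)^2}<0$. *)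

theory Defs
  imports "HOL-Analysis.Analysis"
begin

text \<open>The functions below are total on the reals; they carry their intended meaning only
  for arguments \<open>0 < r < 1\<close>.\<close>

definition elliptic_K :: "real \<Rightarrow> real" where
  "elliptic_K r = integral {0..pi/2} (\<lambda>t. 1 / sqrt (1 - r\<^sup>2 * (sin t)\<^sup>2))"

definition compl_modulus :: "real \<Rightarrow> real" where
  "compl_modulus r = sqrt (1 - r\<^sup>2)"

definition groetzsch_mu :: "real \<Rightarrow> real" where
  "groetzsch_mu r = pi / 2 * (elliptic_K (compl_modulus r) / elliptic_K r)"

text \<open>One Newton step, started at \<open>r\<close>, for solving \<open>groetzsch_mu r = y\<close>.\<close>

definition newton_mu :: "real \<Rightarrow> real \<Rightarrow> real" where
  "newton_mu y r = r - (groetzsch_mu r - y) / deriv groetzsch_mu r"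

end

theory Submission
  imports Defs
begin

text \<open>
  Write \<open>m = r\<^sup>2\<close> for the parameter and \<open>K\<close>, \<open>E\<close> for the complete elliptic integrals of the
  first and second kind as functions of \<open>m\<close> (\<open>param_K\<close>, \<open>param_E\<close>).  Both derivatives are
  again combinations of \<open>K\<close> and \<open>E\<close>, so the modulus can be differentiated as often as one
  likes without leaving these two functions.

  The quotient rule gives \<open>\<mu>' = - C / w\<close> with \<open>w r = r (1 - r\<^sup>2) K(r\<^sup>2)\<^sup>2\<close> (\<open>mu_weight\<close>), where \<open>C\<close>
  is a positive multiple of Legendre's expression \<open>E K' + E' K - K K'\<close> (\<open>legendre_form\<close>; a prime on
  \<open>K\<close> or \<open>E\<close> means evaluation at \<open>1 - m\<close>).  This expression has derivative zero, hence is
  constant, and it is positive because \<open>E > (1 - m) K\<close>.  Therefore \<open>\<mu>''\<close> has the sign of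
  \<open>w'\<close>, and \<open>w' = K (2 E - (1 + m) K)\<close>.

  So convexity is governed by \<open>2 E - (1 + m) K\<close> (\<open>inflection_form\<close>).  It is strictly
  decreasing in \<open>m\<close>, since \<open>E\<close> decreases while \<open>K > 0\<close> increases.  At \<open>m = 1/4\<close> it is positive,
  again by \<open>E > (1 - m) K\<close>.  At \<open>m = 1/2\<close> it is negative: it is then twice the integral of
  \<open>cos (2 t) / 4\<close> against \<open>1 / sqrt (1 - (sin t)\<^sup>2 / 2)\<close>, the first factor has mean zero and
  decreases, and the second one increases.  The only zero of \<open>2 E - (1 + m) K\<close> thus
  lies strictly between \<open>1/4\<close> and \<open>1/2\<close>, and its square root is the inflection point \<open>a\<close>.

  For the Newton step, \<open>\<mu>(1 / sqrt 2) = \<pi> / 2\<close> because the modulus \<open>1 / sqrt 2\<close> is its own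
  complement.  By the mean value theorem the step has length
  \<open>(1 / sqrt 2 - a) \<mu>'(x) / \<mu>'(a) = (1 / sqrt 2 - a) w(a) / w(x)\<close> for some \<open>x\<close> between \<open>a\<close> and
  \<open>1 / sqrt 2\<close>.  On this short interval the ratio of the weights is below \<open>3/2\<close>, and
  \<open>a + (3/2) (1 / sqrt 2 - a) < 1\<close>.
\<close>

section \<open>Complete elliptic integrals as functions of the parameter\<close>

definition legendre_delta :: "real \<Rightarrow> real \<Rightarrow> real" where
  "legendre_delta m t = sqrt (1 - m * (sin t)\<^sup>2)"

definition param_K :: "real \<Rightarrow> real" where
  "param_K m = integral {0..pi/2} (\<lambda>t. 1 / legendre_delta m t)"

definition param_E :: "real \<Rightarrow> real" where
  "param_E m = integral {0..pi/2} (legendre_delta m)"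

lemma one_minus_sin_squared_pos:
  fixes m t :: real
  assumes "m < 1"
  shows "0 < 1 - m * (sin t)\<^sup>2"
proof (cases "m \<le> 0")
  case True
  then have "m * (sin t)\<^sup>2 \<le> 0"
    by (simp add: mult_nonpos_nonneg)
  then show ?thesis by linarith
next
  case False
  have "m * (sin t)\<^sup>2 \<le> m * 1"
    using False by (intro mult_left_mono) (auto simp: power2_le_iff_abs_le abs_square_le_1)
  then show ?thesis using assms by linarith
qed

lemma legendre_delta_pos: "m < 1 \<Longrightarrow> 0 < legendre_delta m t"
  using one_minus_sin_squared_pos[of m t] by (simp add: legendre_delta_def)

lemma legendre_delta_squared: "m < 1 \<Longrightarrow> (legendre_delta m t)\<^sup>2 = 1 - m * (sin t)\<^sup>2"
  using one_minus_sin_squared_pos[of m t] by (simp add: legendre_delta_def)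

lemma legendre_delta_antimono: "m \<le> n \<Longrightarrow> legendre_delta n t \<le> legendre_delta m t"
  by (simp add: legendre_delta_def mult_right_mono)

lemma continuous_on_legendre_delta [continuous_intros]:
  fixes A :: "'a::t2_space set"
  assumes "continuous_on A f" "continuous_on A g"
  shows "continuous_on A (\<lambda>z. legendre_delta (f z) (g z))"
  unfolding legendre_delta_def by (intro continuous_intros assms)

lemma has_real_derivative_delta_param:
  assumes "m < 1"
  shows "((\<lambda>m. legendre_delta m t) has_real_derivative
           - (sin t)\<^sup>2 / (2 * legendre_delta m t)) (at m within A)"
  unfolding legendre_delta_def using one_minus_sin_squared_pos[OF assms, of t]
  by (auto intro!: derivative_eq_intros simp: field_simps)

lemma has_real_derivative_delta_angle:
  assumes "m < 1"
  shows "(legendre_delta m has_real_derivative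
           - m * sin t * cos t / legendre_delta m t) (at t within A)"
  unfolding legendre_delta_def using one_minus_sin_squared_pos[OF assms, of t]
  by (auto intro!: derivative_eq_intros simp: field_simps)

lemma integrable_inverse_delta:
  "m < 1 \<Longrightarrow> (\<lambda>t. 1 / legendre_delta m t) integrable_on {0..pi/2}"
  by (intro integrable_continuous_real continuous_intros) (simp add: less_imp_neq[OF legendre_delta_pos, symmetric])

lemma integrable_delta: "legendre_delta m integrable_on {0..pi/2}"
  by (intro integrable_continuous_real continuous_on_legendre_delta continuous_intros)

lemma quarter_period_nonempty: "{0<..<pi/2} \<noteq> {}"
  using pi_half_gt_zero by (simp del: pi_half_gt_zero add: not_le)

lemma param_K_pos:
  assumes "m < 1" shows "0 < param_K m"
proof -
  have "integral {0..pi/2} (\<lambda>t. 0) < integral {0..pi/2} (\<lambda>t. 1 / legendre_delta m t)"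
    using legendre_delta_pos[OF assms]
    by (intro integral_less_real continuous_intros quarter_period_nonempty)
       (auto simp: less_imp_neq[OF legendre_delta_pos, symmetric] assms)
  then show ?thesis by (simp add: param_K_def)
qed

lemma param_K_mono:
  assumes "m \<le> n" "n < 1" shows "param_K m \<le> param_K n"
  unfolding param_K_def
  using assms legendre_delta_antimono[OF assms(1)] legendre_delta_pos[OF assms(2)]
  by (intro integral_le integrable_inverse_delta) (auto intro!: divide_left_mono mult_pos_pos legendre_delta_pos)

lemma param_E_antimono:
  assumes "m \<le> n" shows "param_E n \<le> param_E m"
  unfolding param_E_def
  by (intro integral_le integrable_delta legendre_delta_antimono assms)

text \<open>The linear combinations of the two integrals that occur below all become a single
  integral whose sign can be read off its numerator.\<close>

lemma param_E_minus_K: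
  assumes "m < 1"
  shows "param_E m - c * param_K m
       = integral {0..pi/2} (\<lambda>t. (1 - m * (sin t)\<^sup>2 - c) / legendre_delta m t)"
proof -
  have "((\<lambda>t. legendre_delta m t - c * (1 / legendre_delta m t)) has_integral
          (param_E m - c * param_K m)) {0..pi/2}"
    unfolding param_E_def param_K_def using assms
    by (intro has_integral_diff has_integral_mult_right integrable_integral
        integrable_delta integrable_inverse_delta)
  moreover have "legendre_delta m t - c * (1 / legendre_delta m t)
      = (1 - m * (sin t)\<^sup>2 - c) / legendre_delta m t" for t
    using legendre_delta_pos[OF assms, of t] legendre_delta_squared[OF assms, of t]
    by (simp add: field_simps power2_eq_square)
  ultimately show ?thesis by (simp add: integral_unique)
qed

text \<open>The difference of the two sides is \<open>m\<close> times the integral of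
  \<open>(cos t)\<^sup>2 / legendre_delta m t\<close>.\<close>

lemma param_E_greater:
  assumes "0 < m" "m < 1"
  shows "(1 - m) * param_K m < param_E m"
proof -
  have "integral {0..pi/2} (\<lambda>t. 0)
      < integral {0..pi/2} (\<lambda>t. (1 - m * (sin t)\<^sup>2 - (1 - m)) / legendre_delta m t)"
  proof (intro integral_less_real continuous_intros quarter_period_nonempty)
    fix t :: real assume "t \<in> {0<..<pi/2}"
    then have "0 < cos t" by (intro cos_gt_zero_pi) auto
    then have "0 < m * (cos t)\<^sup>2" using assms by simp
    also have "m * (cos t)\<^sup>2 = 1 - m * (sin t)\<^sup>2 - (1 - m)"
      by (simp add: cos_squared_eq algebra_simps)
    finally show "0 < (1 - m * (sin t)\<^sup>2 - (1 - m)) / legendre_delta m t"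
      using legendre_delta_pos[OF assms(2)] by simp
  qed (auto simp: less_imp_neq[OF legendre_delta_pos, symmetric] assms)
  then show ?thesis using param_E_minus_K[OF assms(2), of "1 - m"] by simp
qed

section \<open>Derivatives and the Legendre relation\<close>

lemma has_real_derivative_param_E:
  assumes "0 < m" "m < 1"
  shows "(param_E has_real_derivative (param_E m - param_K m) / (2 * m)) (at m)"
proof -
  have "((\<lambda>m. integral (cbox 0 (pi/2)) (legendre_delta m)) has_field_derivative
          integral (cbox 0 (pi/2)) (\<lambda>t. - (sin t)\<^sup>2 / (2 * legendre_delta m t)))
          (at m within {..<1})"
  proof (rule leibniz_rule_field_derivative[where fx = "\<lambda>m t. - (sin t)\<^sup>2 / (2 * legendre_delta m t)"])
    show "continuous_on ({..<1} \<times> cbox 0 (pi/2))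
            (\<lambda>(m, t). - (sin t)\<^sup>2 / (2 * legendre_delta m t))"
      unfolding split_beta
      by (intro continuous_intros) (auto simp: less_imp_neq[OF legendre_delta_pos, symmetric])
    fix n t :: real assume "n \<in> {..<1}"
    then show "((\<lambda>m. legendre_delta m t) has_field_derivative
        - (sin t)\<^sup>2 / (2 * legendre_delta n t)) (at n within {..<1})"
      by (intro has_real_derivative_delta_param) simp
  qed (use assms integrable_delta in auto)
  moreover have "integral {0..pi/2} (\<lambda>t. - (sin t)\<^sup>2 / (2 * legendre_delta m t))
      = (param_E m - param_K m) / (2 * m)"
  proof -
    have "(param_E m - 1 * param_K m) / (2 * m)
        = integral {0..pi/2} (\<lambda>t. (1 - m * (sin t)\<^sup>2 - 1) / legendre_delta m t / (2 * m))"
      unfolding param_E_minus_K[OF assms(2)] by (rule integral_divide[symmetric])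
    also have "(\<lambda>t. (1 - m * (sin t)\<^sup>2 - 1) / legendre_delta m t / (2 * m))
        = (\<lambda>t. - (sin t)\<^sup>2 / (2 * legendre_delta m t))"
      using assms by (auto simp: fun_eq_iff field_simps)
    finally show ?thesis by simp
  qed
  ultimately show ?thesis
    using assms by (simp add: at_within_open[of m "{..<1}"] flip: param_E_def)
qed

text \<open>Differentiation under the integral sign produces the integral of
  \<open>(sin t)\<^sup>2 / (2 (legendre_delta m t)\<^sup>3)\<close>.  It is brought back to \<open>K\<close> and \<open>E\<close> by integrating the
  derivative of \<open>sin t cos t / legendre_delta m t\<close>, which vanishes at both end points: this
  trades the third power for the integral of \<open>(cos t)\<^sup>2 / legendre_delta m t\<close>.\<close>

lemma has_real_derivative_param_K:
  assumes "0 < m" "m < 1"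
  shows "(param_K has_real_derivative
            (param_E m - (1 - m) * param_K m) / (2 * m * (1 - m))) (at m)"
proof -
  let ?D = "legendre_delta m"
  have D: "0 < ?D t" "(?D t)\<^sup>2 = 1 - m * (sin t)\<^sup>2" for t
    using assms legendre_delta_pos legendre_delta_squared by auto
  have D0: "?D t \<noteq> 0" for t using D(1)[of t] by simp
  have deriv: "((\<lambda>m. integral (cbox 0 (pi/2)) (\<lambda>t. 1 / legendre_delta m t)) has_field_derivative
          integral (cbox 0 (pi/2)) (\<lambda>t. (sin t)\<^sup>2 / (2 * ?D t ^ 3)))
          (at m within {..<1})"
  proof (rule leibniz_rule_field_derivative[where fx = "\<lambda>m t. (sin t)\<^sup>2 / (2 * legendre_delta m t ^ 3)"])
    show "continuous_on ({..<1} \<times> cbox 0 (pi/2))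
            (\<lambda>(m, t). (sin t)\<^sup>2 / (2 * legendre_delta m t ^ 3))"
      unfolding split_beta
      by (intro continuous_intros) (auto simp: less_imp_neq[OF legendre_delta_pos, symmetric])
    fix n t :: real assume "n \<in> {..<1}"
    then have n: "n < 1" by simp
    show "((\<lambda>m. 1 / legendre_delta m t) has_field_derivative
        (sin t)\<^sup>2 / (2 * legendre_delta n t ^ 3)) (at n within {..<1})"
      using legendre_delta_pos[OF n, of t]
      by (auto intro!: derivative_eq_intros has_real_derivative_delta_param n
          simp: field_simps power2_eq_square power3_eq_cube)
  qed (use assms in \<open>auto simp: integrable_inverse_delta\<close>)
  have "((\<lambda>t. ((cos t)\<^sup>2 / ?D t - (1 - m) * (sin t)\<^sup>2 / ?D t ^ 3)) has_integral
          (sin (pi/2) * cos (pi/2) / ?D (pi/2) - sin 0 * cos 0 / ?D 0)) {0..pi/2}"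
  proof (rule fundamental_theorem_of_calculus)
    fix t :: real
    let ?s = "sin t" and ?c = "cos t" and ?d = "?D t"
    have "((\<lambda>t. sin t * cos t / ?D t) has_real_derivative
        ((?c * ?c - ?s * ?s) * ?d - ?s * ?c * (- m * ?s * ?c / ?d)) / ?d\<^sup>2) (at t within {0..pi/2})"
      using D0[of t] assms
      by (auto intro!: derivative_eq_intros has_real_derivative_delta_angle simp: power2_eq_square)
    also have "((?c * ?c - ?s * ?s) * ?d - ?s * ?c * (- m * ?s * ?c / ?d)) / ?d\<^sup>2
        = ((?c\<^sup>2 - ?s\<^sup>2) * ?d\<^sup>2 + m * ?s\<^sup>2 * ?c\<^sup>2) / ?d ^ 3"
      using D0[of t] by (simp add: field_simps power2_eq_square power3_eq_cube)
    also have "(?c\<^sup>2 - ?s\<^sup>2) * ?d\<^sup>2 + m * ?s\<^sup>2 * ?c\<^sup>2 = ?c\<^sup>2 * ?d\<^sup>2 - (1 - m) * ?s\<^sup>2"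
      unfolding D(2) cos_squared_eq by algebra
    also have "\<dots> / ?d ^ 3 = ?c\<^sup>2 / ?d - (1 - m) * ?s\<^sup>2 / ?d ^ 3"
      using D0[of t] by (simp add: field_simps power2_eq_square power3_eq_cube)
    finally show "((\<lambda>t. sin t * cos t / ?D t) has_vector_derivative
        ?c\<^sup>2 / ?d - (1 - m) * ?s\<^sup>2 / ?d ^ 3) (at t within {0..pi/2})"
      by (simp add: has_real_derivative_iff_has_vector_derivative)
  qed simp
  then have boundary: "integral {0..pi/2} (\<lambda>t. (cos t)\<^sup>2 / ?D t - (1 - m) * (sin t)\<^sup>2 / ?D t ^ 3) = 0"
    by (simp add: integral_unique)
  have int_B: "(\<lambda>t. (cos t)\<^sup>2 / ?D t) integrable_on {0..pi/2}"
    and int_S: "(\<lambda>t. (sin t)\<^sup>2 / (2 * ?D t ^ 3)) integrable_on {0..pi/2}"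
    using D0 by (auto intro!: integrable_continuous_real continuous_intros)
  have halve: "(1 - m) * s / d = 2 * (1 - m) * (s / (2 * d))" for s d :: real
    by (cases "d = 0") (simp_all add: field_simps)
  have "integral {0..pi/2} (\<lambda>t. (cos t)\<^sup>2 / ?D t - (1 - m) * (sin t)\<^sup>2 / ?D t ^ 3)
      = integral {0..pi/2} (\<lambda>t. (cos t)\<^sup>2 / ?D t - 2 * (1 - m) * ((sin t)\<^sup>2 / (2 * ?D t ^ 3)))"
    unfolding halve ..
  also have "\<dots> = integral {0..pi/2} (\<lambda>t. (cos t)\<^sup>2 / ?D t)
      - 2 * (1 - m) * integral {0..pi/2} (\<lambda>t. (sin t)\<^sup>2 / (2 * ?D t ^ 3))"
    by (intro integral_unique has_integral_diff has_integral_mult_right integrable_integral int_B int_S)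
  finally have S: "2 * (1 - m) * integral {0..pi/2} (\<lambda>t. (sin t)\<^sup>2 / (2 * ?D t ^ 3))
      = integral {0..pi/2} (\<lambda>t. (cos t)\<^sup>2 / ?D t)"
    using boundary by simp
  have "param_E m - (1 - m) * param_K m
      = integral {0..pi/2} (\<lambda>t. m * ((cos t)\<^sup>2 / ?D t))"
    unfolding param_E_minus_K[OF assms(2)]
    by (intro integral_cong) (simp add: cos_squared_eq algebra_simps)
  also have "\<dots> = m * integral {0..pi/2} (\<lambda>t. (cos t)\<^sup>2 / ?D t)"
    by (rule integral_mult_right)
  finally have "integral {0..pi/2} (\<lambda>t. (sin t)\<^sup>2 / (2 * ?D t ^ 3))
      = (param_E m - (1 - m) * param_K m) / (2 * m * (1 - m))"
    using assms by (simp flip: S)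
  then show ?thesis
    using deriv assms by (simp add: at_within_open[of m "{..<1}"] flip: param_K_def)
qed

text \<open>The left-hand side of the Legendre relation; up to sign and the factor \<open>2 m (1 - m)\<close> it is also
  the Wronskian of \<open>K(m)\<close> and \<open>K(1 - m)\<close>, which is how it enters the derivative of the modulus.\<close>

definition legendre_form :: "real \<Rightarrow> real" where
  "legendre_form m = param_E m * param_K (1 - m) + param_E (1 - m) * param_K m
                     - param_K m * param_K (1 - m)"

lemma legendre_form_pos:
  assumes "0 < m" "m < 1" shows "0 < legendre_form m"
proof -
  have "0 < param_K (1 - m) * (param_E m - (1 - m) * param_K m)
          + param_K m * (param_E (1 - m) - m * param_K (1 - m))"
    using assms param_E_greater[of m] param_E_greater[of "1 - m"]
    by (intro add_pos_pos mult_pos_pos param_K_pos) auto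
  then show ?thesis by (simp add: legendre_form_def algebra_simps)
qed

text \<open>The left-hand side is what the product rule yields for \<open>legendre_form\<close> at \<open>x\<close>, with
  \<open>k, e\<close> the values of \<open>K, E\<close> at \<open>x\<close> and \<open>k', e'\<close> those at \<open>1 - x\<close>.\<close>

lemma legendre_form_derivative_cancels:
  fixes x k k' e e' :: real
  assumes "0 < x" "x < 1"
  shows "(e - k) / (2 * x) * k'
         + (e' - (1 - (1 - x)) * k') / (2 * (1 - x) * (1 - (1 - x))) * - 1 * e
         + ((e' - k') / (2 * (1 - x)) * - 1 * k
            + (e - (1 - x) * k) / (2 * x * (1 - x)) * e')
         - ((e - (1 - x) * k) / (2 * x * (1 - x)) * k'
            + (e' - (1 - (1 - x)) * k') / (2 * (1 - x) * (1 - (1 - x))) * - 1 * k) = 0"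
proof -
  define y where "y = 1 - x"
  have nz: "x \<noteq> 0" "y \<noteq> 0" and x: "1 - y = x" using assms by (auto simp: y_def)
  have numerator: "y * ((e - k) * k') - (e' - x * k') * e - x * ((e' - k') * k) + (e - y * k) * e'
        - (e - y * k) * k' + (e' - x * k') * k = 0" (is "?N = 0")
    unfolding y_def by algebra
  have "(e - k) / (2 * x) * k' + (e' - x * k') / (2 * y * x) * - 1 * e
         + ((e' - k') / (2 * y) * - 1 * k + (e - y * k) / (2 * x * y) * e')
         - ((e - y * k) / (2 * x * y) * k' + (e' - x * k') / (2 * y * x) * - 1 * k)
      = ?N / (2 * x * y)"
    using nz by (simp add: field_simps)
  then show ?thesis
    unfolding y_def[symmetric] x numerator by simp
qed

lemma legendre_form_const:
  assumes "0 < m" "m < 1" "0 < n" "n < 1"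
  shows "legendre_form m = legendre_form n"
proof (rule DERIV_isconst3[where f = legendre_form and a = 0 and b = 1])
  fix x :: real assume "x \<in> {0<..<1}"
  then have x: "0 < x" "x < 1" by auto
  then have y: "0 < 1 - x" "1 - x < 1" by auto
  note K = has_real_derivative_param_K[OF x] and E = has_real_derivative_param_E[OF x]
  have flip: "((\<lambda>x. 1 - x) has_real_derivative -1) (at x)"
    by (auto intro!: derivative_eq_intros)
  note K' = DERIV_chain2[OF has_real_derivative_param_K[OF y] flip]
  note E' = DERIV_chain2[OF has_real_derivative_param_E[OF y] flip]
  have "DERIV (\<lambda>m. param_E m * param_K (1 - m) + param_E (1 - m) * param_K m
                     - param_K m * param_K (1 - m)) x :> 0"
    by (rule DERIV_cong[OF DERIV_diff[OF DERIV_add[OF DERIV_mult[OF E K'] DERIV_mult[OF E' K]]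
          DERIV_mult[OF K K']]])
       (rule legendre_form_derivative_cancels[OF x])
  then show "DERIV legendre_form x :> 0"
    by (simp add: legendre_form_def[abs_def])
qed (use assms in auto)

section \<open>The modulus function\<close>

lemma elliptic_K_eq_param_K: "elliptic_K r = param_K (r\<^sup>2)"
  by (simp add: elliptic_K_def param_K_def legendre_delta_def)

lemma groetzsch_mu_eq:
  assumes "0 < r" "r < 1"
  shows "groetzsch_mu r = pi / 2 * (param_K (1 - r\<^sup>2) / param_K (r\<^sup>2))"
  using assms by (simp add: groetzsch_mu_def elliptic_K_eq_param_K compl_modulus_def power_le_one)

definition mu_weight :: "real \<Rightarrow> real" where
  "mu_weight r = r * (1 - r\<^sup>2) * (param_K (r\<^sup>2))\<^sup>2"

lemma square_in_unit:
  fixes r :: real assumes "0 < r" "r < 1" shows "0 < r\<^sup>2" "r\<^sup>2 < 1"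
  using assms by (auto simp: power_less_one_iff abs_square_less_1)

lemma mu_weight_pos:
  assumes "0 < r" "r < 1" shows "0 < mu_weight r"
  using assms square_in_unit[OF assms] param_K_pos[of "r\<^sup>2"] by (simp add: mu_weight_def)

text \<open>The quotient rule for \<open>K(1 - r\<^sup>2) / K(r\<^sup>2)\<close>, with the values of the integrals abstracted to
  variables as in \<open>legendre_form_derivative_cancels\<close>.\<close>

lemma modulus_derivative_algebra:
  fixes r k k' e e' c :: real
  assumes "r \<noteq> 0" "1 - r\<^sup>2 \<noteq> 0" "k \<noteq> 0"
  shows "c * (((e' - (1 - (1 - r\<^sup>2)) * k') / (2 * (1 - r\<^sup>2) * (1 - (1 - r\<^sup>2))) * - (2 * r) * k
              - k' * ((e - (1 - r\<^sup>2) * k) / (2 * r\<^sup>2 * (1 - r\<^sup>2)) * (2 * r))) / (k * k))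
       = - (c * (e * k' + e' * k - k * k')) / (r * (1 - r\<^sup>2) * k\<^sup>2)"
proof -
  define y where "y = 1 - r\<^sup>2"
  have nz: "r \<noteq> 0" "y \<noteq> 0" "k \<noteq> 0" and x: "1 - y = r\<^sup>2" using assms by (auto simp: y_def)
  have L: "e * k' + e' * k - k * k' = (e' - r\<^sup>2 * k') * k + k' * (e - y * k)"
    by (simp add: y_def algebra_simps)
  show ?thesis
    unfolding y_def[symmetric] x L using nz
    by (simp add: field_simps power2_eq_square)
qed

text \<open>The constant value of \<open>legendre_form\<close> is expressed as its value at the symmetric
  parameter \<open>1/2\<close>, so that the numerator does not depend on \<open>r\<close>.\<close>

lemma has_real_derivative_groetzsch_mu:
  assumes r: "0 < r" "r < 1"
  shows "(groetzsch_mu has_real_derivative - (pi / 2 * legendre_form (1/2)) / mu_weight r) (at r)"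
proof -
  note x = square_in_unit[OF r]
  then have y: "0 < 1 - r\<^sup>2" "1 - r\<^sup>2 < 1" by auto
  have sq: "((\<lambda>r. r\<^sup>2) has_real_derivative 2 * r) (at r)"
    and csq: "((\<lambda>r. 1 - r\<^sup>2) has_real_derivative - (2 * r)) (at r)"
    by (auto intro!: derivative_eq_intros)
  note K = DERIV_chain2[OF has_real_derivative_param_K[OF x] sq]
  note K' = DERIV_chain2[OF has_real_derivative_param_K[OF y] csq]
  have pos: "0 < param_K (r\<^sup>2)" using x param_K_pos by simp
  have "((\<lambda>r. pi / 2 * (param_K (1 - r\<^sup>2) / param_K (r\<^sup>2))) has_real_derivative
      - (pi / 2 * legendre_form (r\<^sup>2)) / mu_weight r) (at r)"
  proof (rule DERIV_cong[OF DERIV_cmult[OF DERIV_divide[OF K' K]]])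
    show "pi / 2 * (((param_E (1 - r\<^sup>2) - (1 - (1 - r\<^sup>2)) * param_K (1 - r\<^sup>2))
            / (2 * (1 - r\<^sup>2) * (1 - (1 - r\<^sup>2))) * - (2 * r) * param_K (r\<^sup>2)
          - param_K (1 - r\<^sup>2) * ((param_E (r\<^sup>2) - (1 - r\<^sup>2) * param_K (r\<^sup>2))
            / (2 * r\<^sup>2 * (1 - r\<^sup>2)) * (2 * r)))
         / (param_K (r\<^sup>2) * param_K (r\<^sup>2)))
      = - (pi / 2 * legendre_form (r\<^sup>2)) / mu_weight r"
      unfolding legendre_form_def mu_weight_def
      using pos x r by (intro modulus_derivative_algebra) auto
  qed (use pos in simp)
  then have "((\<lambda>r. pi / 2 * (param_K (1 - r\<^sup>2) / param_K (r\<^sup>2))) has_real_derivative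
      - (pi / 2 * legendre_form (1/2)) / mu_weight r) (at r)"
    using legendre_form_const[OF x, of "1/2"] by simp
  then show ?thesis
    by (rule has_field_derivative_transform_within_open[where S = "{0<..<1}"])
       (use r groetzsch_mu_eq in auto)
qed

definition inflection_form :: "real \<Rightarrow> real" where
  "inflection_form m = 2 * param_E m - (1 + m) * param_K m"

text \<open>The factor \<open>K\<close> splits off because \<open>2 m (1 - m)\<close> times the derivative of \<open>K\<close> is linear in
  \<open>K\<close> and \<open>E\<close>.\<close>

lemma has_real_derivative_mu_weight:
  assumes r: "0 < r" "r < 1"
  shows "(mu_weight has_real_derivative param_K (r\<^sup>2) * inflection_form (r\<^sup>2)) (at r)"
proof -
  note x = square_in_unit[OF r]
  have sq: "((\<lambda>r. r\<^sup>2) has_real_derivative 2 * r) (at r)"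
    by (auto intro!: derivative_eq_intros)
  note K = DERIV_chain2[OF has_real_derivative_param_K[OF x] sq]
  have "r \<noteq> 0" "1 - r\<^sup>2 \<noteq> 0" using x r by auto
  then show ?thesis
    unfolding mu_weight_def[abs_def] inflection_form_def
    by (auto intro!: derivative_eq_intros K simp: divide_simps) algebra
qed

lemma deriv_deriv_groetzsch_mu:
  assumes r: "0 < r" "r < 1"
  shows "deriv (deriv groetzsch_mu) r
       = pi / 2 * legendre_form (1/2) * (param_K (r\<^sup>2) * inflection_form (r\<^sup>2)) / (mu_weight r)\<^sup>2"
proof (rule DERIV_imp_deriv)
  have "((\<lambda>r. - (pi / 2 * legendre_form (1/2)) / mu_weight r) has_real_derivative
      pi / 2 * legendre_form (1/2) * (param_K (r\<^sup>2) * inflection_form (r\<^sup>2)) / (mu_weight r)\<^sup>2) (at r)"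
    using mu_weight_pos[OF r]
    by (auto intro!: derivative_eq_intros has_real_derivative_mu_weight[OF r]
        simp: power2_eq_square)
  then show "(deriv groetzsch_mu has_real_derivative
      pi / 2 * legendre_form (1/2) * (param_K (r\<^sup>2) * inflection_form (r\<^sup>2)) / (mu_weight r)\<^sup>2) (at r)"
    by (rule has_field_derivative_transform_within_open[where S = "{0<..<1}"])
       (use r in \<open>auto simp: DERIV_imp_deriv[OF has_real_derivative_groetzsch_mu]\<close>)
qed

lemma sgn_deriv_deriv_groetzsch_mu:
  assumes r: "0 < r" "r < 1"
  shows "sgn (deriv (deriv groetzsch_mu) r) = sgn (inflection_form (r\<^sup>2))"
  using mu_weight_pos[OF r] legendre_form_pos[of "1/2"] param_K_pos[of "r\<^sup>2"] square_in_unit[OF r]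
  by (simp add: deriv_deriv_groetzsch_mu[OF r] sgn_mult sgn_divide)

section \<open>The inflection point\<close>

lemma inflection_form_strict_antimono:
  assumes "-1 \<le> m" "m < n" "n < 1"
  shows "inflection_form n < inflection_form m"
proof -
  have "(1 + m) * param_K m \<le> (1 + m) * param_K n"
    using assms by (intro mult_left_mono param_K_mono) auto
  also have "\<dots> < (1 + n) * param_K n"
    using assms param_K_pos[of n] by simp
  finally show ?thesis
    using param_E_antimono[of m n] assms by (simp add: inflection_form_def)
qed

lemma inflection_form_quarter: "0 < inflection_form (1/4)"
  using param_E_greater[of "1/4"] param_K_pos[of "1/4"] by (simp add: inflection_form_def)

text \<open>A Chebyshev-type argument: for a function \<open>\<phi>\<close> with mean zero, here
  \<open>\<phi> t = cos (2 t) / 4\<close>, subtracting a constant from the factor \<open>1 / legendre_delta (1/2) t\<close>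
  leaves the integral of the product unchanged.  Taking the constant to be the value of that
  factor where \<open>\<phi>\<close> changes sign, namely at \<open>(sin t)\<^sup>2 = 1/2\<close>, gives the product a constant
  sign.\<close>

lemma inflection_form_half: "inflection_form (1/2) < 0"
proof -
  let ?D = "legendre_delta (1/2)" and ?c = "sqrt (3/4)"
  define f where "f t = cos (2 * t) / 4 * (1 / ?c - 1 / ?D t)" for t
  have half: "(1/2::real) < 1" by simp
  have split: "x / d = x / c - x * (1 / c - 1 / d)" for x c d :: real
    by (simp add: right_diff_distrib)
  have cos_double: "cos (2 * t) / 4 = 1 - 1/2 * (sin t)\<^sup>2 - 3/4" for t :: real
    by (simp add: cos_double_sin)
  have D: "0 < ?D t" "?D t = sqrt (1 - (sin t)\<^sup>2 / 2)" for t
    by (simp_all add: legendre_delta_pos) (simp add: legendre_delta_def)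
  have cont: "continuous_on {0..pi/2} f"
    unfolding f_def using D(1) by (intro continuous_intros) (auto simp: less_imp_neq[symmetric])
  have nonneg: "0 \<le> f t" for t
  proof (cases "(sin t)\<^sup>2 \<le> 1/2")
    case True
    then have "?c \<le> ?D t" unfolding D(2) by (intro real_sqrt_le_mono) simp
    then have "1 / ?D t \<le> 1 / ?c" by (intro divide_left_mono mult_pos_pos D) auto
    with True show ?thesis unfolding f_def cos_double by (intro mult_nonneg_nonneg) auto
  next
    case False
    then have "?D t \<le> ?c" unfolding D(2) by (intro real_sqrt_le_mono) simp
    then have "1 / ?c \<le> 1 / ?D t" by (intro divide_left_mono mult_pos_pos D) auto
    with False show ?thesis unfolding f_def cos_double by (intro mult_nonpos_nonpos) auto
  qed
  \<comment> \<open>A continuous nonnegative integrand with a nonzero value has a positive integral.\<close>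
  have "?c < sqrt 1" by (rule real_sqrt_less_mono) simp
  then have "f 0 \<noteq> 0" by (simp add: f_def legendre_delta_def)
  then have "integral {0..pi/2} f \<noteq> 0"
    using integral_eq_0_iff[OF cont] nonneg by force
  moreover have "0 \<le> integral {0..pi/2} f"
    using nonneg by (intro integral_nonneg integrable_continuous_real cont) auto
  ultimately have pos: "0 < integral {0..pi/2} f" by simp
  have "((\<lambda>t. cos (2 * t) / 4) has_integral (sin (2 * (pi/2)) / 8 - sin (2 * 0) / 8)) {0..pi/2}"
    by (rule fundamental_theorem_of_calculus)
       (auto intro!: derivative_eq_intros simp flip: has_real_derivative_iff_has_vector_derivative)
  then have zero: "integral {0..pi/2} (\<lambda>t. cos (2 * t) / 4 / ?c) = 0"
    unfolding integral_divide[of _ "\<lambda>t. cos (2 * t) / 4"] by (simp only: integral_unique) simp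
  have "param_E (1/2) - 3/4 * param_K (1/2)
      = integral {0..pi/2} (\<lambda>t. cos (2 * t) / 4 / ?c - f t)"
    unfolding param_E_minus_K[OF half] by (simp only: f_def split[of _ "?D _" ?c, symmetric] flip: cos_double)
  also have "\<dots> = integral {0..pi/2} (\<lambda>t. cos (2 * t) / 4 / ?c) - integral {0..pi/2} f"
    by (intro integral_diff integrable_continuous_real cont continuous_intros) auto
  finally show ?thesis using pos zero by (simp add: inflection_form_def)
qed

lemma inflection_form_zero:
  obtains m where "1/4 < m" "m < 1/2" "inflection_form m = 0"
proof -
  have "continuous_on {1/4..1/2} param_E"
    by (rule DERIV_continuous_on, rule has_field_derivative_at_within,
        rule has_real_derivative_param_E) auto
  moreover have "continuous_on {1/4..1/2} param_K"
    by (rule DERIV_continuous_on, rule has_field_derivative_at_within,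
        rule has_real_derivative_param_K) auto
  ultimately have "continuous_on {1/4..1/2} inflection_form"
    unfolding inflection_form_def by (intro continuous_intros)
  then obtain m where m: "1/4 \<le> m" "m \<le> 1/2" "inflection_form m = 0"
    using IVT2'[of inflection_form "1/2" 0 "1/4"] inflection_form_quarter inflection_form_half
    by auto
  moreover have "m \<noteq> 1/4" "m \<noteq> 1/2"
    using m(3) inflection_form_quarter inflection_form_half by (metis less_irrefl)+
  ultimately show ?thesis using that[of m] by force
qed

section \<open>The Newton step\<close>

text \<open>The factor \<open>r\<close> and the factor \<open>K\<close> of the weight increase, so only \<open>1 - r\<^sup>2\<close> can push the
  ratio above \<open>1\<close>, and it falls from at most \<open>3/4\<close> to at least \<open>1/2\<close>.\<close>

lemma mu_weight_ratio:
  assumes "1/2 < a" "a < x" "x < 1 / sqrt 2"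
  shows "mu_weight a < 3/2 * mu_weight x"
proof -
  have "x\<^sup>2 < (1 / sqrt 2)\<^sup>2" using assms by (intro power_strict_mono) auto
  then have x2: "x\<^sup>2 < 1/2" by (simp add: power_divide)
  have a2: "(1/2)\<^sup>2 < a\<^sup>2" using assms by (intro power_strict_mono) auto
  have ax: "a\<^sup>2 < x\<^sup>2" using assms by (intro power_strict_mono) auto
  have "1 - a\<^sup>2 < 3/2 * (1 - x\<^sup>2)" using x2 a2 by (simp add: power2_eq_square)
  then have "a * (1 - a\<^sup>2) < x * (3/2 * (1 - x\<^sup>2))"
    using assms x2 ax by (intro mult_strict_mono) auto
  moreover have "(param_K (a\<^sup>2))\<^sup>2 \<le> (param_K (x\<^sup>2))\<^sup>2"
  proof (rule power_mono, rule param_K_mono)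
    show "0 \<le> param_K (a\<^sup>2)" using ax x2 by (intro less_imp_le param_K_pos) linarith
  qed (use ax x2 in linarith)+
  ultimately have "a * (1 - a\<^sup>2) * (param_K (a\<^sup>2))\<^sup>2 < x * (3/2 * (1 - x\<^sup>2)) * (param_K (x\<^sup>2))\<^sup>2"
  proof (rule mult_less_le_imp_less)
    show "0 \<le> a * (1 - a\<^sup>2)" using assms x2 ax by (intro mult_nonneg_nonneg) auto
    show "0 < (param_K (a\<^sup>2))\<^sup>2" using param_K_pos[of "a\<^sup>2"] x2 ax by simp
  qed
  then show ?thesis by (simp only: mu_weight_def mult_ac)
qed

lemma groetzsch_mu_symmetric_point: "groetzsch_mu (1 / sqrt 2) = pi / 2"
proof -
  have half: "(1 / sqrt 2)\<^sup>2 = (1/2 :: real)" by (simp add: power_divide)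
  have "groetzsch_mu (1 / sqrt 2) = pi / 2 * (param_K (1 - 1/2) / param_K (1/2))"
    using groetzsch_mu_eq[of "1 / sqrt 2"] unfolding half by simp
  then show ?thesis
    using param_K_pos[of "1/2"] by simp
qed

lemma newton_mu_less_one:
  assumes a: "1/2 < a" "a < 1 / sqrt 2"
  shows "newton_mu (pi/2) a < 1"
proof -
  define C where "C = pi / 2 * legendre_form (1/2)"
  have C: "0 < C" using legendre_form_pos[of "1/2"] by (simp add: C_def)
  have b: "1 / sqrt 2 < (1::real)" by simp
  have deriv: "(groetzsch_mu has_real_derivative - C / mu_weight r) (at r)"
    if "a \<le> r" "r \<le> 1 / sqrt 2" for r
    unfolding C_def by (rule has_real_derivative_groetzsch_mu) (use that a b in linarith)+
  obtain x where x: "a < x" "x < 1 / sqrt 2"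
    and mvt: "groetzsch_mu (1 / sqrt 2) - groetzsch_mu a
          = (1 / sqrt 2 - a) * (- C / mu_weight x)"
    using MVT2[OF a(2) deriv] by blast
  have pos: "0 < mu_weight a" "0 < mu_weight x"
    by (rule mu_weight_pos; use a b x in linarith)+
  have "deriv groetzsch_mu a = - C / mu_weight a"
    using a by (intro DERIV_imp_deriv deriv) auto
  moreover have "groetzsch_mu a - pi / 2 = (1 / sqrt 2 - a) * (C / mu_weight x)"
    using mvt by (simp add: groetzsch_mu_symmetric_point)
  ultimately have "newton_mu (pi/2) a
      = a - (1 / sqrt 2 - a) * (C / mu_weight x) / (- C / mu_weight a)"
    by (simp only: newton_mu_def)
  also have "\<dots> = a + (1 / sqrt 2 - a) * (mu_weight a / mu_weight x)"
    using C by simp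
  also have "\<dots> \<le> a + (1 / sqrt 2 - a) * (3/2)"
    using mu_weight_ratio[OF a(1) x] pos a
    by (intro add_left_mono mult_left_mono) (auto simp: field_simps)
  also have "\<dots> < 1"
  proof -
    have "1 / sqrt 2 \<le> (3/4 :: real)"
      using real_le_rsqrt[of "4/3" 2] by (simp add: field_simps power2_eq_square)
    then show ?thesis using a by argo
  qed
  finally show ?thesis .
qed

theorem lemma3p1:
  shows "\<exists>a::real.
      (1 / 2 < a \<and> a < 1 / sqrt 2 \<and>
       (\<forall>r. 0 < r \<and> r < a \<longrightarrow> deriv (deriv groetzsch_mu) r > 0) \<and>
       (\<forall>r. a < r \<and> r < 1 \<longrightarrow> deriv (deriv groetzsch_mu) r < 0)) \<and>
      (\<forall>b::real.
       (1 / 2 < b \<and> b < 1 / sqrt 2 \<and>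
        (\<forall>r. 0 < r \<and> r < b \<longrightarrow> deriv (deriv groetzsch_mu) r > 0) \<and>
        (\<forall>r. b < r \<and> r < 1 \<longrightarrow> deriv (deriv groetzsch_mu) r < 0)) \<longrightarrow> b = a) \<and>
      newton_mu (pi / 2) a < 1"
proof -
  obtain m where m: "1/4 < m" "m < 1/2" "inflection_form m = 0"
    by (rule inflection_form_zero)
  define a where "a = sqrt m"
  have a_sq: "a\<^sup>2 = m" using m by (simp add: a_def)
  have "sqrt (1/4) < a" unfolding a_def using m by (intro real_sqrt_less_mono)
  then have a_lo: "1/2 < a" by (simp add: real_sqrt_divide)
  have "a < sqrt (1/2)" unfolding a_def using m by (intro real_sqrt_less_mono)
  then have a_hi: "a < 1 / sqrt 2" by (simp add: real_sqrt_divide)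
  have a_one: "a < 1" using m by (simp add: a_def)
  have convex_part: "deriv (deriv groetzsch_mu) r > 0" if r: "0 < r" "r < a" for r
  proof -
    have "r\<^sup>2 < a\<^sup>2" using r by (intro power_strict_mono) auto
    then have "0 < inflection_form (r\<^sup>2)"
      using inflection_form_strict_antimono[of "r\<^sup>2" m] m a_sq zero_le_power2[of r] by simp
    then show ?thesis
      using sgn_deriv_deriv_groetzsch_mu[of r] r a_one by (simp add: sgn_1_pos)
  qed
  have concave_part: "deriv (deriv groetzsch_mu) r < 0" if r: "a < r" "r < 1" for r
  proof -
    have "a\<^sup>2 < r\<^sup>2" using r a_lo by (intro power_strict_mono) auto
    then have "inflection_form (r\<^sup>2) < 0"
      using inflection_form_strict_antimono[of m "r\<^sup>2"] m a_sq square_in_unit[of r] r a_lo by simp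
    then show ?thesis
      using sgn_deriv_deriv_groetzsch_mu[of r] r a_lo by (simp add: sgn_1_neg)
  qed
  have unique: "b = a"
    if b: "1/2 < b" "b < 1 / sqrt 2"
      and pos: "\<forall>r. 0 < r \<and> r < b \<longrightarrow> deriv (deriv groetzsch_mu) r > 0"
      and neg: "\<forall>r. b < r \<and> r < 1 \<longrightarrow> deriv (deriv groetzsch_mu) r < 0" for b
  proof (rule linorder_cases[of a b])
    assume "a < b"
    then obtain r where "a < r" "r < b" using dense by blast
    moreover have "b < 1" using b(2) by (rule order.strict_trans) simp
    ultimately show ?thesis
      using pos[rule_format, of r] concave_part[of r] a_lo by simp
  next
    assume "b < a"
    then obtain r where "b < r" "r < a" using dense by blast
    then show ?thesis
      using neg[rule_format, of r] convex_part[of r] a_one b by simp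
  qed simp
  show ?thesis
    using a_lo a_hi convex_part concave_part unique newton_mu_less_one[OF a_lo a_hi]
    by (intro exI[of _ a]) blast
qed

end
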